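(* Let $K\geq 8$ be an integer and let $a_1,a_2,\ldots,a_K$ be positive integers whose square-free parts are all distinct. Suppose that $a_n\leq N$ for all $n\leq K$. Then, for any integer $M$ with $1\leq M\leq K$, $$\bigg|\sum_{n\leq M}\sqrt{a_n}-\sum_{M<n\leq K}\sqrt{a_n}\bigg|\geq\frac{C_K\,e^{(2^{K-1}-1)/K}}{(KN)^{2^{K-2}-1/2}},$$ where $C_K:=(1-2^{1-K})^{(2^{K-1}-1)/2}$.
   Context: Every positive integer $a$ can be decomposed as $a=c^2d$ with $c,d$ positive integers and $d$ square-free; $d$ is called the square-free part of $a$. The index $n$ ranges over positive integers, and an empty sum is $0$. *)

theory Defs
  imports Complex_Main "HOL-Computational_Algebra.Squarefree"
begin

definition C :: "nat \<Rightarrow> real" where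
  "C K = (1 - 2 powr (1 - real K)) powr ((2 ^ (K - 1) - 1) / 2)"

end

theory Submission
  imports Defs "HOL-Computational_Algebra.Polynomial"
begin

text \<open>
  Put \<open>S\<^sub>X = (\<Sum>i\<in>X. sqrt (a i)) - (\<Sum>i\<in>I - X. sqrt (a i))\<close> for \<open>X \<subseteq> I = {1..K}\<close>. Square roots of
  numbers with distinct square-free parts are linearly independent over the rationals, so no
  \<open>S\<^sub>X\<close> vanishes. The product of all \<open>2 ^ K\<close> numbers \<open>S\<^sub>X\<close> is unchanged by every sign change
  \<open>sqrt (a i) \<mapsto> - sqrt (a i)\<close> and is therefore an integer. Being non-zero, it has absolute value at
  least 1, which is the inequality \<open>(\<Sum>X. ln (S\<^sub>X\<^sup>2)) \<ge> 0\<close> (\<open>sum_ln_signed_sums_nonneg\<close>). A lower bound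
  for one \<open>\<bar>S\<^sub>X\<bar> = \<bar>S\<^bsub>I - X\<^esub>\<bar>\<close> thus follows from an upper bound for the sum of the other logarithms.

  The mean of \<open>S\<^sub>X\<^sup>2\<close> over all \<open>X\<close> is \<open>\<Sum>i\<in>I. a i\<close>, at most \<open>K N\<close>. By concavity of the logarithm alone
  (the arithmetic-geometric mean inequality) this gives the claim without the exponential factor.
  That factor asks for the mean of \<open>ln (S\<^sub>X\<^sup>2 / (K N))\<close> to be at most about \<open>- 2 / K\<close>, and \<open>- 1/4\<close>
  suffices because \<open>K \<ge> 8\<close>. This much is available: either the \<open>a i\<close> are spread out, and
  then \<open>S\<^sub>X\<close> behaves like a centred Gaussian variable, whose squared value has a logarithm well
  below the logarithm of its mean; or a few of them dominate, and then \<open>\<Sum>i\<in>I. a i\<close> is much smaller than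
  \<open>K N\<close>. Both cases are covered at once by replacing \<open>ln\<close> by a cubic polynomial that lies
  above it and is nearly tangent to it at two points (\<open>ln_le_log_majorant\<close>). The mean of the
  cubic only involves the second, fourth and sixth moments of \<open>S\<^sub>X\<close>, which are explicit in the power sums of the \<open>a i\<close>
  (\<open>signed_sum_moments\<close>), and it is at most \<open>- 13/45\<close> (\<open>cubic_moment_bound\<close>). The gap
  between \<open>13/45\<close> and \<open>1/4\<close>, multiplied by \<open>2 ^ K\<close>, pays for leaving \<open>X\<close> and its complement
  out of the sum, and the bound comes out without the factor \<open>C K \<le> 1\<close>.
\<close>

section \<open>Linear independence of square roots\<close>

text \<open>
  The independence is proved along a tower of real quadratic extensions of the rationals, which
  are kept as bare sets of real numbers.
\<close>

definition real_subfield :: "real set \<Rightarrow> bool" where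
  "real_subfield F \<longleftrightarrow> \<rat> \<subseteq> F \<and> (\<forall>x\<in>F. \<forall>y\<in>F. x + y \<in> F \<and> x * y \<in> F) \<and> (\<forall>x\<in>F. inverse x \<in> F)"

lemma real_subfield_closed:
  assumes "real_subfield F"
  shows "\<And>x. x \<in> \<rat> \<Longrightarrow> x \<in> F"
    and "\<And>x y. x \<in> F \<Longrightarrow> y \<in> F \<Longrightarrow> x + y \<in> F"
    and "\<And>x y. x \<in> F \<Longrightarrow> y \<in> F \<Longrightarrow> x * y \<in> F"
    and "\<And>x. x \<in> F \<Longrightarrow> inverse x \<in> F"
    and "\<And>x y. x \<in> F \<Longrightarrow> y \<in> F \<Longrightarrow> x / y \<in> F"
    and "\<And>x. x \<in> F \<Longrightarrow> - x \<in> F"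
    and "\<And>x y. x \<in> F \<Longrightarrow> y \<in> F \<Longrightarrow> x - y \<in> F"
proof -
  show rat: "x \<in> F" if "x \<in> \<rat>" for x using assms that by (auto simp: real_subfield_def)
  show add: "x + y \<in> F" and mult: "x * y \<in> F" if "x \<in> F" "y \<in> F" for x y
    using assms that by (auto simp: real_subfield_def)
  show inv: "inverse x \<in> F" if "x \<in> F" for x using assms that by (auto simp: real_subfield_def)
  show "x / y \<in> F" if "x \<in> F" "y \<in> F" for x y
    using mult[OF that(1) inv[OF that(2)]] by (simp add: divide_inverse)
  have "(-1::real) \<in> F" by (intro rat) simp
  then show neg: "- x \<in> F" if "x \<in> F" for x using mult[OF _ that, of "-1"] by simp
  show "x - y \<in> F" if "x \<in> F" "y \<in> F" for x y
    using add[OF that(1) neg[OF that(2)]] by simp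
qed

lemma real_subfield_sum:
  assumes "real_subfield F" and "\<And>i. i \<in> I \<Longrightarrow> f i \<in> F"
  shows "(\<Sum>i\<in>I. f i) \<in> F"
  using assms(2)
  by (induction I rule: infinite_finite_induct)
     (auto intro: real_subfield_closed[OF assms(1)])

text \<open>
  Inverses come from the norm: \<open>(a + b * sqrt q) * (a - b * sqrt q) = a\<^sup>2 - b\<^sup>2 * q\<close> lies in \<open>F\<close>, and it does not
  vanish because \<open>sqrt q\<close> is not a quotient of elements of \<open>F\<close>.
\<close>

lemma real_subfield_adjoin_sqrt:
  assumes F: "real_subfield F" and q: "q \<in> F" "q \<ge> 0" and nonsq: "sqrt q \<notin> F"
  shows "real_subfield {x + y * sqrt q | x y. x \<in> F \<and> y \<in> F}" (is "real_subfield ?G")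
  unfolding real_subfield_def
proof (intro conjI ballI subsetI)
  note cl = real_subfield_closed[OF F]
  have zero: "0 \<in> F" by (intro cl) simp
  have adjoinI: "z \<in> ?G" if "z = a + b * sqrt q" "a \<in> F" "b \<in> F" for z a b using that by blast
  fix x :: real
  show "x \<in> ?G" if "x \<in> \<rat>"
    using cl(1)[OF that] zero by (intro adjoinI[of x x 0]) auto
  assume "x \<in> ?G"
  then obtain a b where x: "x = a + b * sqrt q" and ab: "a \<in> F" "b \<in> F" by blast
  show "inverse x \<in> ?G"
  proof (cases "b = 0")
    case True
    then show ?thesis using x cl(4)[OF ab(1)] zero by (intro adjoinI[of _ "inverse a" 0]) auto
  next
    case False
    have ne: "a + b * sqrt q \<noteq> 0" "a - b * sqrt q \<noteq> 0"
    proof -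
      have "a / b \<in> F" "- (a / b) \<in> F" using cl(5)[OF ab] cl(6)[OF cl(5)[OF ab]] by simp_all
      then have "sqrt q \<noteq> a / b" "sqrt q \<noteq> - (a / b)" using nonsq by auto
      then show "a + b * sqrt q \<noteq> 0" "a - b * sqrt q \<noteq> 0" using False by (auto simp: field_simps)
    qed
    define n where "n = a * a - b * b * q"
    have n: "n = (a + b * sqrt q) * (a - b * sqrt q)"
      using q(2) by (simp add: n_def algebra_simps)
    have "n \<noteq> 0" using ne n by simp
    have "x * (a - b * sqrt q) = n" using n x by simp
    with \<open>n \<noteq> 0\<close> ne x have "inverse x = (a - b * sqrt q) / n" by (simp add: field_simps)
    also have "\<dots> = a / n + (- b / n) * sqrt q" by (simp add: diff_divide_distrib)
    finally show ?thesis
      unfolding n_def by (rule adjoinI) (intro cl(3,5,6,7) ab q(1))+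
  qed
  fix y assume "y \<in> ?G"
  then obtain c d where y: "y = c + d * sqrt q" and cd: "c \<in> F" "d \<in> F" by blast
  show "x + y \<in> ?G"
    using ab cd by (intro adjoinI[of _ "a + c" "b + d"] cl(2)) (simp_all add: x y algebra_simps)
  have "x * y = (a * c + b * d * q) + (a * d + b * c) * sqrt q"
    using q(2) by (simp add: x y algebra_simps)
  then show "x * y \<in> ?G" by (rule adjoinI) (intro cl(2,3) ab cd q(1))+
qed

fun multiquadratic :: "nat list \<Rightarrow> real set" where
  "multiquadratic [] = \<rat>"
| "multiquadratic (q # qs) =
     {x + y * sqrt (real q) | x y. x \<in> multiquadratic qs \<and> y \<in> multiquadratic qs}"

lemma sqrt_squarefree_irrational:
  assumes "squarefree m" "m > (1::nat)"
  shows "sqrt (real m) \<notin> \<rat>"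
proof
  assume "sqrt (real m) \<in> \<rat>"
  then obtain a b :: nat where ab: "b \<noteq> 0" "\<bar>sqrt (real m)\<bar> = real a / real b" "coprime a b"
    by (rule Rats_abs_nat_div_natE)
  then have "sqrt (real m) * real b = real a" by (simp add: field_simps)
  then have "real m * real b ^ 2 = real a ^ 2"
    by (metis of_nat_0_le_iff power_mult_distrib real_sqrt_pow2)
  then have eq: "m * b ^ 2 = a ^ 2" by (metis of_nat_eq_iff of_nat_mult of_nat_power)
  have "coprime (a ^ 2) (b ^ 2)" using ab(3) by simp
  moreover have "b ^ 2 dvd a ^ 2" using eq by (metis dvd_triv_right)
  ultimately have "b ^ 2 = 1" by (metis coprime_absorb_right nat_dvd_1_iff_1)
  with eq have "m = a ^ 2" by simp
  with assms(1) have "is_unit a" by (auto simp: squarefree_def)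
  with \<open>m = a ^ 2\<close> assms(2) show False by simp
qed

text \<open>
  Being a field and missing the remaining square roots have to be proved together: the step
  needs \<open>sqrt q\<close> to be outside the smaller field \<open>F\<close>. If \<open>sqrt m = x + y * sqrt q\<close> with \<open>x\<close> and \<open>y\<close> in \<open>F\<close>, squaring
  shows that one of \<open>sqrt m\<close> (when \<open>y = 0\<close>), \<open>sqrt (m * q)\<close> (when \<open>x = 0\<close>) and \<open>sqrt q\<close> (otherwise)
  lies in \<open>F\<close>. The induction hypothesis excludes all three, which is why it ranges over all square-free
  \<open>m\<close> and not only over primes.
\<close>

lemma multiquadratic_subfield_and_sqrt_notin:
  assumes "distinct qs" "\<And>q. q \<in> set qs \<Longrightarrow> prime q"
  shows "real_subfield (multiquadratic qs) \<and>
    (\<forall>m. squarefree m \<and> m > 1 \<and> (\<forall>q\<in>set qs. \<not> q dvd m) \<longrightarrow> sqrt (real m) \<notin> multiquadratic qs)"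
  using assms
proof (induction qs)
  case Nil
  then show ?case by (auto simp: real_subfield_def sqrt_squarefree_irrational)
next
  case (Cons q qs)
  let ?F = "multiquadratic qs"
  from Cons have F: "real_subfield ?F"
    and notin: "\<And>m. squarefree m \<Longrightarrow> m > 1 \<Longrightarrow> (\<forall>p\<in>set qs. \<not> p dvd m) \<Longrightarrow> sqrt (real m) \<notin> ?F"
    by auto
  note cl = real_subfield_closed[OF F]
  have q: "prime q" and qqs: "\<forall>p\<in>set qs. \<not> p dvd q"
    using Cons.prems by (simp_all, metis primes_dvd_imp_eq)
  have q_notin: "sqrt (real q) \<notin> ?F"
    using notin[of q] q qqs prime_gt_1_nat[OF q] by (simp add: squarefree_prime)
  have nat_in: "real n \<in> ?F" for n by (intro cl) simp
  show ?case
  proof (intro conjI allI impI)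
    show "real_subfield (multiquadratic (q # qs))"
      using real_subfield_adjoin_sqrt[OF F nat_in _ q_notin] by simp
  next
    fix m assume m: "squarefree m \<and> 1 < m \<and> (\<forall>p\<in>set (q # qs). \<not> p dvd m)"
    show "sqrt (real m) \<notin> multiquadratic (q # qs)"
    proof
      assume "sqrt (real m) \<in> multiquadratic (q # qs)"
      then obtain x y where xy: "x \<in> ?F" "y \<in> ?F" and eq: "sqrt (real m) = x + y * sqrt (real q)"
        by auto
      have "real m = (x + y * sqrt (real q)) ^ 2" by (simp flip: eq)
      then have sq: "real m = x ^ 2 + y ^ 2 * real q + 2 * x * y * sqrt (real q)"
        by (simp add: power2_eq_square algebra_simps)
      consider "y = 0" | "x = 0" | "x \<noteq> 0" "y \<noteq> 0" by blast
      then show False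
      proof cases
        case 1
        then show ?thesis using eq xy notin[of m] m by auto
      next
        case 2
        have "coprime m q" using m q by (metis coprime_commute list.set_intros(1) prime_imp_coprime)
        then have "squarefree (m * q)" using m q by (simp add: squarefree_mult_coprime squarefree_prime)
        moreover have "m * q > 1" using m q by (metis less_1_mult prime_gt_1_nat)
        moreover have "\<forall>p\<in>set qs. \<not> p dvd m * q"
          using m qqs Cons.prems(2) by (auto simp: prime_dvd_mult_iff)
        ultimately have "sqrt (real (m * q)) \<notin> ?F" by (rule notin)
        moreover have "sqrt (real (m * q)) = y * real q"
          using eq 2 by (simp add: real_sqrt_mult)
        ultimately show ?thesis using cl(3)[OF xy(2) nat_in] by metis
      next
        case 3
        then have "sqrt (real q) = (real m - (x * x + y * y * real q)) / (2 * x * y)"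
          using sq by (simp add: field_simps power2_eq_square)
        moreover have "(2::real) \<in> ?F" using nat_in[of 2] by simp
        ultimately have "sqrt (real q) \<in> ?F"
          using xy nat_in by (metis cl(2,3,5,7))
        with q_notin show ?thesis by contradiction
      qed
    qed
  qed
qed

lemma squarefree_prime_mult_cofactor:
  fixes q n :: nat
  assumes "prime q" "squarefree (q * n)"
  shows "squarefree n" "prime_factors n \<subseteq> prime_factors (q * n) - {q}"
proof -
  show "squarefree n" using assms(2) by (rule squarefree_multD)
  have "q * n \<noteq> 0" using assms(2) by (metis not_squarefree_0)
  moreover have "\<not> q dvd n"
  proof
    assume "q dvd n"
    then have "q ^ 2 dvd q * n" by (simp add: power2_eq_square)
    with assms(2) have "is_unit q" by (auto simp: squarefree_def)
    with assms(1) show False by (simp add: not_prime_unit)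
  qed
  ultimately show "prime_factors n \<subseteq> prime_factors (q * n) - {q}"
    using dvd_prime_factors[of "q * n" n] by (auto dest: in_prime_factors_imp_dvd)
qed

lemma squarefree_no_prime_factors:
  fixes m :: nat
  assumes "squarefree m" "prime_factors m = {}"
  shows "m = 1"
  using assms by (cases "m = 0") (auto simp: prime_factorization_empty_iff)

lemma sqrt_mem_multiquadratic:
  assumes "distinct qs" "\<And>q. q \<in> set qs \<Longrightarrow> prime q"
    and "squarefree m" "prime_factors m \<subseteq> set qs"
  shows "sqrt (real m) \<in> multiquadratic qs"
  using assms
proof (induction qs arbitrary: m)
  case Nil
  then have "m = 1" by (intro squarefree_no_prime_factors) auto
  then show ?case by simp
next
  case (Cons q qs)
  let ?F = "multiquadratic qs"
  have F: "real_subfield ?F"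
    using multiquadratic_subfield_and_sqrt_notin[of qs] Cons.prems by auto
  have zero: "0 \<in> ?F" by (intro real_subfield_closed[OF F]) simp
  have adjoinI: "z \<in> multiquadratic (q # qs)"
    if "z = a + b * sqrt (real q)" "a \<in> ?F" "b \<in> ?F" for z a b
    using that by auto
  show ?case
  proof (cases "q dvd m")
    case False
    then have "prime_factors m \<subseteq> set qs" using Cons.prems(4) by (auto simp: prime_factors_dvd)
    then have "sqrt (real m) \<in> ?F" using Cons by auto
    then show ?thesis using zero adjoinI[of "sqrt (real m)" "sqrt (real m)" 0] by simp
  next
    case True
    then obtain n where n: "m = q * n" by blast
    then have "squarefree n" "prime_factors n \<subseteq> set qs"
      using squarefree_prime_mult_cofactor[of q n] Cons.prems by auto
    then have "sqrt (real n) \<in> ?F" using Cons by auto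
    then show ?thesis using zero n adjoinI[of "sqrt (real m)" 0 "sqrt (real n)"]
      by (simp add: real_sqrt_mult)
  qed
qed

text \<open>
  The terms divisible by the first prime \<open>q\<close> carry a common factor \<open>sqrt q\<close>, so a relation reads
  \<open>\<alpha> + \<beta> * sqrt q = 0\<close> with \<open>\<alpha>\<close> and \<open>\<beta>\<close> in the field of the other primes. As \<open>sqrt q\<close> is not in that
  field, \<open>\<beta> = 0\<close> and \<open>\<alpha> = 0\<close>, which are two relations with fewer primes.
\<close>

lemma sqrt_squarefree_linear_independent_aux:
  assumes "distinct qs" "\<And>q. q \<in> set qs \<Longrightarrow> prime q"
    and "finite D" "\<And>d. d \<in> D \<Longrightarrow> squarefree d \<and> prime_factors d \<subseteq> set qs"
    and "\<And>d. d \<in> D \<Longrightarrow> c d \<in> \<rat>"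
    and "(\<Sum>d\<in>D. c d * sqrt (real d)) = 0"
  shows "\<forall>d\<in>D. c d = 0"
  using assms
proof (induction qs arbitrary: D c)
  case Nil
  have "D \<subseteq> {1}"
  proof
    fix d assume "d \<in> D"
    then have "squarefree d" "prime_factors d = {}" using Nil.prems(4)[of d] by simp_all
    then show "d \<in> {1}" using squarefree_no_prime_factors by blast
  qed
  then have "D = {} \<or> D = {1}" by auto
  then show ?case using Nil.prems(6) by (elim disjE) simp_all
next
  case (Cons q qs)
  let ?F = "multiquadratic qs"
  have qs: "distinct qs" "\<And>p. p \<in> set qs \<Longrightarrow> prime p" and q: "prime q" and qqs: "\<forall>p\<in>set qs. \<not> p dvd q"
    using Cons.prems(1,2) by (simp_all, metis primes_dvd_imp_eq)
  have F: "real_subfield ?F"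
    and q_notin: "sqrt (real q) \<notin> ?F"
    using multiquadratic_subfield_and_sqrt_notin[OF qs] q qqs prime_gt_1_nat[OF q]
    by (simp_all add: squarefree_prime)
  note cl = real_subfield_closed[OF F]
  define D0 where "D0 = {d \<in> D. \<not> q dvd d}"
  define E where "E = {e. q * e \<in> D}"
  have q0: "q > 0" using q by (simp add: prime_gt_0_nat)
  have injq: "inj_on ((*) q) E" using q0 by (auto simp: inj_on_def)
  have D: "D = D0 \<union> (*) q ` E" "D0 \<inter> (*) q ` E = {}" by (auto simp: D0_def E_def)
  have fin: "finite D0" "finite E"
    using Cons.prems(3) D(1) injq by (metis finite_Un, metis finite_Un finite_imageD)
  have D0: "squarefree d \<and> prime_factors d \<subseteq> set qs" if "d \<in> D0" for d
    using that Cons.prems(4)[of d] by (auto simp: D0_def prime_factors_dvd)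
  have E: "squarefree e \<and> prime_factors e \<subseteq> set qs" if "e \<in> E" for e
  proof -
    have sf: "squarefree (q * e)" "prime_factors (q * e) \<subseteq> set (q # qs)"
      using that Cons.prems(4)[of "q * e"] by (auto simp: E_def)
    then show ?thesis using squarefree_prime_mult_cofactor[OF q sf(1)] by auto
  qed
  define \<alpha> \<beta> where "\<alpha> = (\<Sum>d\<in>D0. c d * sqrt (real d))" and "\<beta> = (\<Sum>e\<in>E. c (q * e) * sqrt (real e))"
  have "0 = (\<Sum>d\<in>D0. c d * sqrt (real d)) + (\<Sum>d\<in>(*) q ` E. c d * sqrt (real d))"
    using Cons.prems(6) fin D(2) by (subst (asm) (1) D(1)) (simp add: sum.union_disjoint)
  also have "(\<Sum>d\<in>(*) q ` E. c d * sqrt (real d)) = \<beta> * sqrt (real q)"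
    unfolding sum.reindex[OF injq] \<beta>_def sum_distrib_right
    by (intro sum.cong) (simp_all add: real_sqrt_mult)
  finally have rel: "\<alpha> + \<beta> * sqrt (real q) = 0" by (simp add: \<alpha>_def)
  have mem: "\<alpha> \<in> ?F" "\<beta> \<in> ?F"
    unfolding \<alpha>_def \<beta>_def
    by (intro real_subfield_sum[OF F] cl(3) cl(1)[OF Cons.prems(5)] sqrt_mem_multiquadratic[OF qs];
        use D0 E in \<open>auto simp: D0_def E_def\<close>)+
  have "\<beta> = 0"
  proof (rule ccontr)
    assume "\<beta> \<noteq> 0"
    then have "sqrt (real q) = - (\<alpha> / \<beta>)" using rel by (simp add: field_simps)
    with q_notin mem cl(5,6) show False by metis
  qed
  with rel have "\<alpha> = 0" by simp
  have "\<forall>d\<in>D0. c d = 0"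
    using Cons.prems(5) \<open>\<alpha> = 0\<close> fin qs D0 by (intro Cons.IH) (auto simp: \<alpha>_def D0_def)
  moreover have "\<forall>e\<in>E. c (q * e) = 0"
    using Cons.prems(5) \<open>\<beta> = 0\<close> fin qs E by (intro Cons.IH) (auto simp: \<beta>_def E_def)
  ultimately show ?case by (subst D(1)) auto
qed

lemma sqrt_squarefree_linear_independent:
  fixes c :: "nat \<Rightarrow> real"
  assumes "finite D" "\<And>d. d \<in> D \<Longrightarrow> squarefree d" "\<And>d. d \<in> D \<Longrightarrow> c d \<in> \<rat>"
    and "(\<Sum>d\<in>D. c d * sqrt (real d)) = 0" and "d \<in> D"
  shows "c d = 0"
proof -
  obtain qs where qs: "set qs = (\<Union>d\<in>D. prime_factors d)" "distinct qs"
    using finite_distinct_list[of "\<Union>d\<in>D. prime_factors d"] assms(1) by auto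
  have "\<forall>d\<in>D. c d = 0"
    by (rule sqrt_squarefree_linear_independent_aux[of qs]) (use qs assms in auto)
  then show ?thesis using assms(5) by blast
qed

text \<open>A pattern of signs is given by the set \<open>X\<close> of the indices with a plus sign.\<close>

definition signed_sum :: "('i \<Rightarrow> real) \<Rightarrow> 'i set \<Rightarrow> 'i set \<Rightarrow> real" where
  "signed_sum r I X = (\<Sum>i\<in>I. if i \<in> X then r i else - r i)"

text \<open>
  Writing \<open>a i = d * c\<^sup>2\<close> with \<open>d\<close> square-free turns the signed sum into a combination of the roots
  of distinct square-free numbers with coefficients \<open>\<plusminus> c\<close>.
\<close>

lemma signed_sum_sqrt_nonzero:
  fixes a :: "'i \<Rightarrow> nat"
  assumes "finite I" "I \<noteq> {}" and pos: "\<And>i. i \<in> I \<Longrightarrow> a i > 0"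
    and inj: "inj_on (\<lambda>i. squarefree_part (a i)) I"
  shows "signed_sum (\<lambda>i. sqrt (real (a i))) I X \<noteq> 0"
proof
  assume zero: "signed_sum (\<lambda>i. sqrt (real (a i))) I X = 0"
  let ?s = "\<lambda>i. squarefree_part (a i)"
  define g where "g = the_inv_into I ?s"
  define c where "c = (\<lambda>d. (if g d \<in> X then 1 else -1) * real (square_part (a (g d))))"
  have g: "g (?s i) = i" if "i \<in> I" for i
    unfolding g_def using the_inv_into_f_f[OF inj that] by simp
  have "(\<Sum>d\<in>?s ` I. c d * sqrt (real d)) = (\<Sum>i\<in>I. c (?s i) * sqrt (real (?s i)))"
    by (simp add: sum.reindex[OF inj])
  also have "\<dots> = signed_sum (\<lambda>i. sqrt (real (a i))) I X"
    unfolding signed_sum_def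
  proof (rule sum.cong[OF refl])
    fix i assume i: "i \<in> I"
    have "real (a i) = real (?s i) * real (square_part (a i)) ^ 2"
      by (metis of_nat_mult of_nat_power squarefree_decompose)
    then have "sqrt (real (a i)) = sqrt (real (?s i)) * real (square_part (a i))"
      by (simp add: real_sqrt_mult)
    then show "c (?s i) * sqrt (real (?s i)) =
        (if i \<in> X then sqrt (real (a i)) else - sqrt (real (a i)))"
      by (simp add: c_def g[OF i])
  qed
  finally have rel: "(\<Sum>d\<in>?s ` I. c d * sqrt (real d)) = 0" using zero by simp
  obtain i where i: "i \<in> I" using assms(2) by blast
  have "c (?s i) = 0"
    by (rule sqrt_squarefree_linear_independent[OF _ _ _ rel])
       (use assms(1) i in \<open>auto simp: c_def\<close>)
  moreover have "square_part (a i) \<noteq> 0" using pos[OF i] by simp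
  ultimately show False using g[OF i] by (auto simp: c_def split: if_splits)
qed

section \<open>The product of all signed sums\<close>

lemma split_Pow_insert:
  assumes "finite I" "j \<notin> I"
  shows "sum f (Pow (insert j I)) = (\<Sum>X\<in>Pow I. f X + f (insert j X))"
    and "prod g (Pow (insert j I)) = (\<Prod>X\<in>Pow I. g X * g (insert j X))"
proof -
  have disj: "Pow I \<inter> insert j ` Pow I = {}" using assms(2) by auto
  have inj: "inj_on (insert j) (Pow I)"
  proof (rule inj_onI)
    fix X Y assume "X \<in> Pow I" "Y \<in> Pow I" "insert j X = insert j Y"
    with assms(2) show "X = Y" by (metis PowD insert_ident subsetD)
  qed
  show "sum f (Pow (insert j I)) = (\<Sum>X\<in>Pow I. f X + f (insert j X))"
    unfolding Pow_insert using assms(1) disj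
    by (subst sum.union_disjoint) (simp_all add: sum.reindex[OF inj] sum.distrib)
  show "prod g (Pow (insert j I)) = (\<Prod>X\<in>Pow I. g X * g (insert j X))"
    unfolding Pow_insert using assms(1) disj
    by (subst prod.union_disjoint) (simp_all add: prod.reindex[OF inj] prod.distrib)
qed

lemma signed_sum_insert:
  assumes "finite I" "j \<notin> I" "X \<subseteq> I"
  shows "signed_sum r (insert j I) X = signed_sum r I X - r j"
    and "signed_sum r (insert j I) (insert j X) = signed_sum r I X + r j"
proof -
  show "signed_sum r (insert j I) X = signed_sum r I X - r j"
    using assms by (auto simp: signed_sum_def)
  have "(\<Sum>i\<in>I. if i \<in> insert j X then r i else - r i) = (\<Sum>i\<in>I. if i \<in> X then r i else - r i)"
    using assms by (intro sum.cong) auto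
  then show "signed_sum r (insert j I) (insert j X) = signed_sum r I X + r j"
    using assms by (simp add: signed_sum_def)
qed

text \<open>
  The values at \<open>x + t\<close> and \<open>x - t\<close> are conjugate: even powers of \<open>t\<close> are integers and go into \<open>u\<close>,
  odd powers into \<open>v\<close>. Hence their product \<open>u\<^sup>2 - t\<^sup>2 * v\<^sup>2\<close> has integer coefficients again.
\<close>

lemma int_poly_shift_by_sqrt:
  fixes p :: "real poly"
  assumes "\<And>n. coeff p n \<in> \<int>" and t: "t ^ 2 \<in> \<int>"
  shows "\<exists>u v. (\<forall>n. coeff u n \<in> \<int> \<and> coeff v n \<in> \<int>) \<and>
    (\<forall>x. poly p (x + t) = poly u x + t * poly v x \<and> poly p (x - t) = poly u x - t * poly v x)"
  using assms(1)
proof (induction p)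
  case 0
  then show ?case by (intro exI[of _ 0]) auto
next
  case (pCons c p)
  have "coeff p n \<in> \<int>" for n using pCons.prems[of "Suc n"] by simp
  then obtain u v where uv: "\<And>n. coeff u n \<in> \<int>" "\<And>n. coeff v n \<in> \<int>"
    "\<And>x. poly p (x + t) = poly u x + t * poly v x" "\<And>x. poly p (x - t) = poly u x - t * poly v x"
    using pCons.IH by blast
  have c: "c \<in> \<int>" using pCons.prems[of 0] by simp
  show ?case
  proof (intro exI conjI allI)
    fix n :: nat and x :: real
    show "coeff (pCons c u + smult (t ^ 2) v) n \<in> \<int>" "coeff (u + pCons 0 v) n \<in> \<int>"
      using uv(1,2) c t by (auto simp: coeff_pCons split: nat.splits)
    show "poly (pCons c p) (x + t) = poly (pCons c u + smult (t ^ 2) v) x + t * poly (u + pCons 0 v) x"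
      using uv(3)[of x] by (simp, simp add: algebra_simps power2_eq_square)
    show "poly (pCons c p) (x - t) = poly (pCons c u + smult (t ^ 2) v) x - t * poly (u + pCons 0 v) x"
      using uv(4)[of x] by (simp, simp add: algebra_simps power2_eq_square)
  qed
qed

text \<open>
  The extra variable \<open>x\<close> makes the induction possible: a new index \<open>j\<close> turns the
  polynomial \<open>p(x)\<close> into \<open>p(x - r j) * p(x + r j)\<close>.
\<close>

lemma prod_signed_sums_int_poly:
  fixes r :: "'i \<Rightarrow> real"
  assumes "finite I" "\<And>i. i \<in> I \<Longrightarrow> r i ^ 2 \<in> \<int>"
  shows "\<exists>p. (\<forall>n. coeff p n \<in> \<int>) \<and> (\<forall>x. (\<Prod>X\<in>Pow I. x + signed_sum r I X) = poly p x)"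
  using assms
proof (induction I rule: finite_induct)
  case empty
  then show ?case
    by (intro exI[of _ "[:0, 1:]"]) (auto simp: signed_sum_def coeff_pCons split: nat.splits)
next
  case (insert j I)
  then obtain p where p: "\<And>n. coeff p n \<in> \<int>" "\<And>x. (\<Prod>X\<in>Pow I. x + signed_sum r I X) = poly p x"
    by auto
  have rj: "r j ^ 2 \<in> \<int>" using insert.prems by simp
  obtain u v where uv: "\<And>n. coeff u n \<in> \<int>" "\<And>n. coeff v n \<in> \<int>"
    "\<And>x. poly p (x + r j) = poly u x + r j * poly v x" "\<And>x. poly p (x - r j) = poly u x - r j * poly v x"
    using int_poly_shift_by_sqrt[OF p(1) rj] by blast
  let ?w = "u * u - smult (r j ^ 2) (v * v)"
  have "coeff ?w n \<in> \<int>" for n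
    using uv rj by (auto simp: coeff_mult intro!: Ints_diff Ints_mult Ints_sum)
  moreover have "(\<Prod>X\<in>Pow (insert j I). x + signed_sum r (insert j I) X) = poly ?w x" for x
  proof -
    have "(\<Prod>X\<in>Pow (insert j I). x + signed_sum r (insert j I) X)
        = (\<Prod>X\<in>Pow I. ((x - r j) + signed_sum r I X) * ((x + r j) + signed_sum r I X))"
      unfolding split_Pow_insert(2)[OF insert.hyps(1,2)]
      by (intro prod.cong) (auto simp: signed_sum_insert[OF insert.hyps(1,2)] algebra_simps)
    also have "\<dots> = poly p (x - r j) * poly p (x + r j)" by (simp add: prod.distrib p(2))
    also have "\<dots> = poly ?w x" by (simp add: uv algebra_simps power2_eq_square)
    finally show ?thesis .
  qed
  ultimately show ?case by blast
qed

lemma prod_signed_sums_Ints: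
  fixes r :: "'i \<Rightarrow> real"
  assumes "finite I" "\<And>i. i \<in> I \<Longrightarrow> r i ^ 2 \<in> \<int>"
  shows "(\<Prod>X\<in>Pow I. signed_sum r I X) \<in> \<int>"
proof -
  obtain p where p: "\<And>n. coeff p n \<in> \<int>" "\<And>x. (\<Prod>X\<in>Pow I. x + signed_sum r I X) = poly p x"
    using prod_signed_sums_int_poly[of I r] assms by blast
  show ?thesis using p(2)[of 0] p(1)[of 0] by (simp add: poly_0_coeff_0)
qed

text \<open>
  Divided by \<open>2 ^ card I\<close>, these are the moments of a sum with independent random signs. The leading terms
  \<open>1, 3, 15\<close> are the Gaussian moments; the other terms appear because the fourth and sixth moments
  of a single sign are 1. A new index \<open>j\<close> replaces \<open>S ^ k\<close> by \<open>(S - r j) ^ k + (S + r j) ^ k\<close>.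
\<close>

lemma signed_sum_moments:
  fixes r :: "'i \<Rightarrow> real"
  assumes "finite I"
  defines "P \<equiv> \<lambda>k. \<Sum>i\<in>I. r i ^ k"
  shows "(\<Sum>X\<in>Pow I. signed_sum r I X ^ 2) = 2 ^ card I * P 2"
    and "(\<Sum>X\<in>Pow I. signed_sum r I X ^ 4) = 2 ^ card I * (3 * P 2 ^ 2 - 2 * P 4)"
    and "(\<Sum>X\<in>Pow I. signed_sum r I X ^ 6) = 2 ^ card I * (15 * P 2 ^ 3 - 30 * P 2 * P 4 + 16 * P 6)"
proof -
  have "(\<Sum>X\<in>Pow I. signed_sum r I X ^ 2) = 2 ^ card I * P 2 \<and>
    (\<Sum>X\<in>Pow I. signed_sum r I X ^ 4) = 2 ^ card I * (3 * P 2 ^ 2 - 2 * P 4) \<and>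
    (\<Sum>X\<in>Pow I. signed_sum r I X ^ 6) = 2 ^ card I * (15 * P 2 ^ 3 - 30 * P 2 * P 4 + 16 * P 6)"
    unfolding P_def using assms(1)
  proof (induction I rule: finite_induct)
    case empty
    then show ?case by (simp add: signed_sum_def)
  next
    case (insert j I)
    let ?S = "signed_sum r I"
    have split: "(\<Sum>X\<in>Pow (insert j I). signed_sum r (insert j I) X ^ k)
        = (\<Sum>X\<in>Pow I. (?S X - r j) ^ k + (?S X + r j) ^ k)" for k
      unfolding split_Pow_insert(1)[OF insert.hyps(1,2)]
      by (intro sum.cong) (auto simp: signed_sum_insert[OF insert.hyps(1,2)])
    have e2: "(x - y) ^ 2 + (x + y) ^ 2 = 2 * x ^ 2 + 2 * y ^ 2" for x y :: real
      by (simp add: eval_nat_numeral algebra_simps)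
    have e4: "(x - y) ^ 4 + (x + y) ^ 4 = 2 * x ^ 4 + 12 * y ^ 2 * x ^ 2 + 2 * y ^ 4" for x y :: real
      by (simp add: eval_nat_numeral algebra_simps)
    have e6: "(x - y) ^ 6 + (x + y) ^ 6
        = 2 * x ^ 6 + 30 * y ^ 2 * x ^ 4 + 30 * y ^ 4 * x ^ 2 + 2 * y ^ 6" for x y :: real
      by (simp add: eval_nat_numeral algebra_simps)
    note IH = insert.IH
    have card: "(\<Sum>X\<in>Pow I. c) = 2 ^ card I * c" for c :: real
      using insert.hyps(1) by (simp add: card_Pow)
    let ?p = "\<lambda>k. \<Sum>i\<in>I. r i ^ k"
    have p: "(\<Sum>i\<in>insert j I. r i ^ k) = r j ^ k + ?p k" for k using insert.hyps by simp
    have cI: "(2::real) ^ card (insert j I) = 2 * 2 ^ card I" using insert.hyps by simp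
    have m2: "(\<Sum>X\<in>Pow I. (?S X - r j) ^ 2 + (?S X + r j) ^ 2) = 2 * 2 ^ card I * (r j ^ 2 + ?p 2)"
      unfolding e2 sum.distrib card by (simp add: IH algebra_simps flip: sum_distrib_left)
    have m4: "(\<Sum>X\<in>Pow I. (?S X - r j) ^ 4 + (?S X + r j) ^ 4)
        = 2 * 2 ^ card I * (3 * (r j ^ 2 + ?p 2) ^ 2 - 2 * (r j ^ 4 + ?p 4))"
      unfolding e4 sum.distrib card sum_distrib_left[symmetric] IH[THEN conjunct1]
        IH[THEN conjunct2, THEN conjunct1]
      by algebra
    have m6: "(\<Sum>X\<in>Pow I. (?S X - r j) ^ 6 + (?S X + r j) ^ 6)
        = 2 * 2 ^ card I * (15 * (r j ^ 2 + ?p 2) ^ 3 - 30 * (r j ^ 2 + ?p 2) * (r j ^ 4 + ?p 4)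
            + 16 * (r j ^ 6 + ?p 6))"
      unfolding e6 sum.distrib card sum_distrib_left[symmetric] IH[THEN conjunct1]
        IH[THEN conjunct2, THEN conjunct1] IH[THEN conjunct2, THEN conjunct2]
      by algebra
    show ?case unfolding split p cI using m2 m4 m6 by blast
  qed
  then show "(\<Sum>X\<in>Pow I. signed_sum r I X ^ 2) = 2 ^ card I * P 2"
    and "(\<Sum>X\<in>Pow I. signed_sum r I X ^ 4) = 2 ^ card I * (3 * P 2 ^ 2 - 2 * P 4)"
    and "(\<Sum>X\<in>Pow I. signed_sum r I X ^ 6) = 2 ^ card I * (15 * P 2 ^ 3 - 30 * P 2 * P 4 + 16 * P 6)"
    by auto
qed

section \<open>A cubic majorant of the logarithm\<close>

text \<open>
  The derivative of this cubic minus \<open>1 / x\<close> is \<open>5/36 * (x - 3/5) * (x - 12/5) * (x - 5) / x\<close>, so the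
  distance to \<open>ln\<close> is smallest at \<open>3/5\<close> and at \<open>5\<close>. These points are close to
  the nodes \<open>3 - sqrt 6\<close> and \<open>3 + sqrt 6\<close> of the two-point Gauss quadrature for the square of a Gaussian
  variable, the nodes for which a cubic with double contact gives the best bound for the mean logarithm.
  The middle root \<open>12/5\<close> nearly balances the two minima, and the constant \<open>- 8/5\<close> leaves
  room for crude estimates of \<open>ln (3/5)\<close> and \<open>ln 5\<close>.
\<close>

definition log_majorant :: "real \<Rightarrow> real" where
  "log_majorant x = - 8/5 + 137/60 * x - 5/9 * x ^ 2 + 5/108 * x ^ 3"

lemma ln_le_log_majorant:
  fixes x :: real
  assumes "x > 0"
  shows "ln x \<le> log_majorant x"
proof -
  define f where "f = (\<lambda>x. log_majorant x - ln x)"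
  define f' where "f' = (\<lambda>x::real. 5/36 * ((x - 3/5) * (x - 12/5) * (x - 5)) / x)"
  have deriv: "(f has_real_derivative f' y) (at y)" if "y > 0" for y
    unfolding f_def log_majorant_def f'_def
    using that
    by (auto intro!: derivative_eq_intros simp: field_simps power2_eq_square power3_eq_cube)
  have at_low: "f (3/5) \<ge> 0"
  proof -
    \<comment> \<open>The majorant is \<open>- 21/50\<close> here. The tangent at 1 gives only \<open>- 2/5\<close>, the split \<open>- 9/20\<close>.\<close>
    have "ln (3/5) = ln (3/4 :: real) + ln (4/5)" by (subst ln_mult_pos[symmetric]) auto
    also have "\<dots> \<le> (3/4 - 1) + (4/5 - 1)" by (intro add_mono ln_le_minus_one) auto
    finally show ?thesis by (simp add: f_def log_majorant_def power2_eq_square power3_eq_cube)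
  qed
  have at_high: "f 5 \<ge> 0"
  proof -
    \<comment> \<open>A rational form of \<open>5 \<le> exp (17/10)\<close>.\<close>
    have "(5::real) \<le> (11/10) ^ 17" by (simp add: power_divide)
    then have "ln 5 \<le> ln ((11/10 :: real) ^ 17)" by simp
    also have "\<dots> = 17 * ln (11/10 :: real)" by (subst ln_realpow) auto
    also have "\<dots> \<le> 17 * (11/10 - 1)" by (intro mult_left_mono ln_le_minus_one) auto
    finally show ?thesis by (simp add: f_def log_majorant_def power2_eq_square power3_eq_cube)
  qed
  have dec: "f b \<le> f a" if "0 < a" "a \<le> b" "\<And>y. a \<le> y \<Longrightarrow> y \<le> b \<Longrightarrow> f' y \<le> 0" for a b
  proof (rule DERIV_nonpos_imp_nonincreasing[OF that(2)])
    fix y assume y: "a \<le> y" "y \<le> b"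
    show "\<exists>d. (f has_real_derivative d) (at y) \<and> d \<le> 0"
      using deriv[of y] that(1) that(3)[OF y] y by (intro exI[of _ "f' y"]) simp
  qed
  have inc: "f a \<le> f b" if "0 < a" "a \<le> b" "\<And>y. a \<le> y \<Longrightarrow> y \<le> b \<Longrightarrow> f' y \<ge> 0" for a b
  proof (rule DERIV_nonneg_imp_nondecreasing[OF that(2)])
    fix y assume y: "a \<le> y" "y \<le> b"
    show "\<exists>d. (f has_real_derivative d) (at y) \<and> d \<ge> 0"
      using deriv[of y] that(1) that(3)[OF y] y by (intro exI[of _ "f' y"]) simp
  qed
  consider "x \<le> 3/5" | "3/5 \<le> x" "x \<le> 12/5" | "12/5 \<le> x" "x \<le> 5" | "5 \<le> x" by linarith
  then have "f x \<ge> 0"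
  proof cases
    case 1
    have "f' y \<le> 0" if "x \<le> y" "y \<le> 3/5" for y
    proof -
      have "(y - 3/5) * (y - 12/5) \<ge> 0" by (rule mult_nonpos_nonpos) (use that in auto)
      then have P: "(y - 3/5) * (y - 12/5) * (y - 5) \<le> 0" by (rule mult_nonneg_nonpos) (use that in auto)
      show ?thesis unfolding f'_def
        by (rule divide_nonpos_pos[OF mult_nonneg_nonpos[OF _ P]]) (use that assms in auto)
    qed
    then show ?thesis using dec[of x "3/5"] at_low 1 assms by fastforce
  next
    case 2
    have "f' y \<ge> 0" if "3/5 \<le> y" "y \<le> x" for y
    proof -
      have "(y - 3/5) * (y - 12/5) \<le> 0" by (rule mult_nonneg_nonpos) (use that 2 in auto)
      then have P: "(y - 3/5) * (y - 12/5) * (y - 5) \<ge> 0" by (rule mult_nonpos_nonpos) (use that 2 in auto)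
      show ?thesis unfolding f'_def
        by (rule divide_nonneg_pos[OF mult_nonneg_nonneg[OF _ P]]) (use that in auto)
    qed
    then show ?thesis using inc[of "3/5" x] at_low 2 by fastforce
  next
    case 3
    have "f' y \<le> 0" if "x \<le> y" "y \<le> 5" for y
    proof -
      have "(y - 3/5) * (y - 12/5) \<ge> 0" by (rule mult_nonneg_nonneg) (use that 3 in auto)
      then have P: "(y - 3/5) * (y - 12/5) * (y - 5) \<le> 0" by (rule mult_nonneg_nonpos) (use that in auto)
      show ?thesis unfolding f'_def
        by (rule divide_nonpos_pos[OF mult_nonneg_nonpos[OF _ P]]) (use that assms in auto)
    qed
    then show ?thesis using dec[of x 5] at_high 3 by fastforce
  next
    case 4
    have "f' y \<ge> 0" if "5 \<le> y" "y \<le> x" for y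
    proof -
      have "(y - 3/5) * (y - 12/5) \<ge> 0" by (rule mult_nonneg_nonneg) (use that in auto)
      then have P: "(y - 3/5) * (y - 12/5) * (y - 5) \<ge> 0" by (rule mult_nonneg_nonneg) (use that in auto)
      show ?thesis unfolding f'_def
        by (rule divide_nonneg_pos[OF mult_nonneg_nonneg[OF _ P]]) (use that in auto)
    qed
    then show ?thesis using inc[of 5 x] at_high 4 by fastforce
  qed
  then show ?thesis by (simp add: f_def)
qed

lemma log_majorant_ge:
  assumes "x \<ge> 0"
  shows "- 8/5 \<le> log_majorant x"
proof -
  have "log_majorant x + 8/5 = x * (5/108 * (x - 6) ^ 2 + 37/60)"
    by (simp add: log_majorant_def power2_eq_square power3_eq_cube field_simps)
  moreover have "0 \<le> x * (5/108 * (x - 6) ^ 2 + 37/60)" using assms by simp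
  ultimately show ?thesis by linarith
qed

text \<open>
  The left-hand side is the mean of \<open>log_majorant\<close> for a variable with moments
  \<open>\<alpha>\<close>, \<open>3 * \<alpha>\<^sup>2 - 2 * \<kappa>\<close> and \<open>15 * \<alpha>\<^sup>3 - 30 * \<alpha> * \<kappa> + 16 * \<rho>\<close>. The polynomial \<open>g\<close> is its Gaussian part
  \<open>\<kappa> = \<rho> = 0\<close>, whose maximum on \<open>{0..1}\<close> is \<open>- 13/45\<close>, at \<open>\<alpha> = 1\<close>. With \<open>\<rho>\<close> bounded by \<open>\<kappa> / 8\<close>, the correction is not positive when
  \<open>\<alpha>\<close> is large; when \<open>\<alpha>\<close> is small, \<open>g\<close> is so far below its maximum that the correction does no harm.
\<close>

lemma cubic_moment_bound:
  fixes \<alpha> \<kappa> \<rho> :: real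
  assumes "0 \<le> \<alpha>" "\<alpha> \<le> 1" "0 \<le> \<kappa>" "\<kappa> \<le> \<alpha> / 8" "\<rho> \<le> \<kappa> / 8"
  shows "- 8/5 + 137/60 * \<alpha> - 5/9 * (3 * \<alpha> ^ 2 - 2 * \<kappa>)
      + 5/108 * (15 * \<alpha> ^ 3 - 30 * \<alpha> * \<kappa> + 16 * \<rho>) \<le> - 13/45"
proof -
  define g where "g = - 8/5 + 137/60 * \<alpha> - 5/3 * \<alpha> ^ 2 + 25/36 * \<alpha> ^ 3"
  have upper: "- 8/5 + 137/60 * \<alpha> - 5/9 * (3 * \<alpha> ^ 2 - 2 * \<kappa>)
      + 5/108 * (15 * \<alpha> ^ 3 - 30 * \<alpha> * \<kappa> + 16 * \<rho>) \<le> g + \<kappa> * (65/54 - 25/18 * \<alpha>)"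
    using assms(5) by (simp add: g_def algebra_simps)
  have g: "g = - 13/45 - (1 - \<alpha>) * (25/36 * (\<alpha> - 7/10) ^ 2 + 233/240)"
    by (simp add: g_def power2_eq_square power3_eq_cube field_simps)
  have sq: "0 \<le> (1 - \<alpha>) * (25/36 * (\<alpha> - 7/10) ^ 2)" using assms by simp
  show ?thesis
  proof (cases "\<alpha> \<ge> 13/15")
    case True
    then have "\<kappa> * (65/54 - 25/18 * \<alpha>) \<le> 0" using assms by (intro mult_nonneg_nonpos) auto
    moreover have "g \<le> - 13/45" unfolding g using assms by simp
    ultimately show ?thesis using upper by linarith
  next
    case False
    then have "\<kappa> * (65/54 - 25/18 * \<alpha>) \<le> 1/8 * (65/54 - 25/18 * \<alpha>)"
      using assms by (intro mult_right_mono) auto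
    moreover have "g \<le> - 13/45 - (1 - \<alpha>) * (233/240)"
      unfolding g using sq by (simp add: distrib_left)
    moreover have "- 13/45 - (1 - \<alpha>) * (233/240) + 1/8 * (65/54 - 25/18 * \<alpha>) \<le> - 13/45"
      using False by (simp add: field_simps)
    ultimately show ?thesis using upper by (meson add_mono order_trans)
  qed
qed

section \<open>The lower bound for a signed sum\<close>

lemma sum_ln_signed_sums_nonneg:
  fixes a :: "'i \<Rightarrow> nat"
  assumes "finite I" "\<And>X. X \<subseteq> I \<Longrightarrow> signed_sum (\<lambda>i. sqrt (real (a i))) I X \<noteq> 0"
  shows "0 \<le> (\<Sum>X\<in>Pow I. ln (signed_sum (\<lambda>i. sqrt (real (a i))) I X ^ 2))"
proof -
  let ?S = "signed_sum (\<lambda>i. sqrt (real (a i))) I"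
  have "(\<Prod>X\<in>Pow I. ?S X) \<in> \<int>" using assms(1) by (intro prod_signed_sums_Ints) auto
  moreover have "(\<Prod>X\<in>Pow I. ?S X) \<noteq> 0" using assms by simp
  ultimately have "1 \<le> \<bar>\<Prod>X\<in>Pow I. ?S X\<bar>" by (rule Ints_nonzero_abs_ge1)
  then have "1 \<le> (\<Prod>X\<in>Pow I. ?S X) ^ 2" by (metis one_le_power power2_abs)
  then have "0 \<le> ln (\<Prod>X\<in>Pow I. ?S X ^ 2)" by (simp add: prod_power_distrib)
  also have "\<dots> = (\<Sum>X\<in>Pow I. ln (?S X ^ 2))"
    using assms by (intro ln_prod) auto
  finally show ?thesis .
qed

text \<open>
  With \<open>P k\<close> for the sum of the \<open>k\<close>-th powers of the \<open>a i\<close> and \<open>B = K * N\<close>, the normalised power sums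
  \<open>P k / B ^ k\<close> decrease by a factor of at least \<open>K \<ge> 8\<close> in each step, since \<open>a i \<le> N = B / K\<close>.
\<close>

lemma sum_cubic_signed_sums:
  fixes a :: "'i \<Rightarrow> nat" and N :: real
  assumes "finite I" "card I \<ge> 8" and N: "N > 0" and le: "\<And>i. i \<in> I \<Longrightarrow> real (a i) \<le> N"
  defines "B \<equiv> real (card I) * N"
  shows "(\<Sum>X\<in>Pow I. log_majorant (signed_sum (\<lambda>i. sqrt (real (a i))) I X ^ 2 / B))
    \<le> 2 ^ card I * (- 13/45)"
proof -
  let ?S = "signed_sum (\<lambda>i. sqrt (real (a i))) I"
  define P where "P = (\<lambda>k. \<Sum>i\<in>I. real (a i) ^ k)"
  have B: "B \<ge> 8 * N" "B > 0" unfolding B_def using assms(2) N by (auto intro!: mult_right_mono)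
  have powers: "(\<Sum>i\<in>I. sqrt (real (a i)) ^ (2 * k)) = P k" for k
    unfolding P_def power_mult by simp
  note moments = signed_sum_moments[OF assms(1), of "\<lambda>i. sqrt (real (a i))"]
  have m: "(\<Sum>X\<in>Pow I. ?S X ^ 2) = 2 ^ card I * P 1"
    "(\<Sum>X\<in>Pow I. ?S X ^ 4) = 2 ^ card I * (3 * P 1 ^ 2 - 2 * P 2)"
    "(\<Sum>X\<in>Pow I. ?S X ^ 6) = 2 ^ card I * (15 * P 1 ^ 3 - 30 * P 1 * P 2 + 16 * P 3)"
    using moments powers[of 1] powers[of 2] powers[of 3] by simp_all
  have P_nonneg: "0 \<le> P k" for k unfolding P_def by (intro sum_nonneg) simp
  have P_Suc: "P (Suc k) \<le> N * P k" for k
    unfolding P_def sum_distrib_left power_Suc using le by (intro sum_mono mult_right_mono) auto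
  have P1: "P 1 \<le> B"
    using sum_bounded_above[of I "\<lambda>i. real (a i)" N] le by (simp add: P_def B_def)
  define \<alpha> \<kappa> \<rho> where "\<alpha> = P 1 / B" and "\<kappa> = P 2 / B ^ 2" and "\<rho> = P 3 / B ^ 3"
  have step: "P (Suc k) / B ^ Suc k \<le> P k / B ^ k / 8" for k
  proof -
    have "8 * P (Suc k) \<le> 8 * N * P k" using P_Suc[of k] by simp
    also have "\<dots> \<le> B * P k" using B(1) P_nonneg by (rule mult_right_mono)
    finally show ?thesis using B(2) by (simp add: field_simps)
  qed
  have "(\<Sum>X\<in>Pow I. log_majorant (?S X ^ 2 / B)) = 2 ^ card I * (- 8/5)
      + 137/60 * ((\<Sum>X\<in>Pow I. ?S X ^ 2) / B) - 5/9 * ((\<Sum>X\<in>Pow I. ?S X ^ 4) / B ^ 2)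
      + 5/108 * ((\<Sum>X\<in>Pow I. ?S X ^ 6) / B ^ 3)"
    using assms(1)
    by (simp add: log_majorant_def sum.distrib sum_subtractf power_divide card_Pow
          flip: sum_distrib_left sum_divide_distrib power_mult)
  also have "\<dots> = 2 ^ card I * (- 8/5 + 137/60 * \<alpha> - 5/9 * (3 * \<alpha> ^ 2 - 2 * \<kappa>)
      + 5/108 * (15 * \<alpha> ^ 3 - 30 * \<alpha> * \<kappa> + 16 * \<rho>))"
    unfolding m \<alpha>_def \<kappa>_def \<rho>_def using B(2)
    by (simp add: field_simps power2_eq_square power3_eq_cube)
  also have "\<dots> \<le> 2 ^ card I * (- 13/45)"
  proof (rule mult_left_mono[OF cubic_moment_bound])
    show "0 \<le> \<alpha>" "\<alpha> \<le> 1" "0 \<le> \<kappa>"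
      using P_nonneg P1 B(2) by (simp_all add: \<alpha>_def \<kappa>_def)
    show "\<kappa> \<le> \<alpha> / 8" "\<rho> \<le> \<kappa> / 8"
      using step[of 1] step[of 2] by (simp_all add: \<alpha>_def \<kappa>_def \<rho>_def numeral_2_eq_2 numeral_3_eq_3)
  qed simp
  finally show ?thesis .
qed

lemma signed_sum_complement:
  assumes "X \<subseteq> I"
  shows "signed_sum r I (I - X) = - signed_sum r I X"
  unfolding signed_sum_def sum_negf[symmetric] using assms by (intro sum.cong) auto

text \<open>
  Both \<open>X\<close> and its complement are left out of the sum of logarithms, as they give the same
  \<open>\<bar>S\<^sub>X\<bar>\<close>; the remaining \<open>2 ^ K - 2\<close> terms are bounded by the cubic. Summing the cubic over all patterns
  instead costs at most \<open>2 * 8/5\<close>, because it is bounded below by \<open>- 8/5\<close>.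
\<close>

lemma ln_signed_sum_lower_bound:
  fixes a :: "'i \<Rightarrow> nat" and N :: real
  assumes I: "finite I" "card I \<ge> 8" and pos: "\<And>i. i \<in> I \<Longrightarrow> a i > 0"
    and inj: "inj_on (\<lambda>i. squarefree_part (a i)) I"
    and N: "\<And>i. i \<in> I \<Longrightarrow> real (a i) \<le> N" and X: "X \<subseteq> I"
  defines "K \<equiv> card I"
  shows "(2 ^ (K - 1) - 1) * (2 / real K - ln (real K * N))
    \<le> ln (signed_sum (\<lambda>i. sqrt (real (a i))) I X ^ 2)"
proof -
  let ?S = "signed_sum (\<lambda>i. sqrt (real (a i))) I"
  define B L where "B = real K * N" and "L = (2::real) ^ (K - 1)"
  have "I \<noteq> {}" using I by auto
  then obtain i where "i \<in> I" by blast
  then have "N > 0" using pos[of i] N[of i] by linarith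
  then have "B > 0" using I(2) by (simp add: B_def K_def)
  have nz: "?S Y \<noteq> 0" for Y
    using I(1) \<open>I \<noteq> {}\<close> pos inj by (rule signed_sum_sqrt_nonzero)
  have K: "K \<ge> 8" using I(2) by (simp add: K_def)
  have twoL: "(2::real) ^ K = 2 * L" using K by (simp add: L_def flip: power_Suc)
  define T where "T = {X, I - X}"
  have T: "T \<subseteq> Pow I" "finite T" using X by (auto simp: T_def)
  have "X \<noteq> I - X" using \<open>I \<noteq> {}\<close> X by blast
  then have sum_T: "sum g T = g X + g (I - X)" for g :: "'i set \<Rightarrow> real" by (simp add: T_def)
  have card_rest: "real (card (Pow I - T)) = 2 * L - 2"
  proof -
    have "card T = 2" using \<open>X \<noteq> I - X\<close> by (simp add: T_def)
    moreover have "card T \<le> card (Pow I)" using T(1) I(1) by (intro card_mono) auto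
    ultimately show ?thesis
      using T I(1) twoL by (simp add: card_Diff_subset card_Pow of_nat_diff K_def)
  qed
  have split: "sum g (Pow I) = sum g (Pow I - T) + sum g T" for g :: "'i set \<Rightarrow> real"
    using T(1) I(1) by (intro sum.subset_diff) auto
  let ?q = "\<lambda>Y. log_majorant (?S Y ^ 2 / B)"
  have "0 \<le> (\<Sum>Y\<in>Pow I. ln (?S Y ^ 2))" using I(1) nz by (rule sum_ln_signed_sums_nonneg)
  also have "\<dots> = (\<Sum>Y\<in>Pow I - T. ln (?S Y ^ 2)) + 2 * ln (?S X ^ 2)"
    unfolding split sum_T signed_sum_complement[OF X] by simp
  also have "(\<Sum>Y\<in>Pow I - T. ln (?S Y ^ 2)) \<le> (\<Sum>Y\<in>Pow I - T. ln B + ?q Y)"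
  proof (rule sum_mono)
    fix Y
    have "ln (?S Y ^ 2 / B) \<le> ?q Y" using nz \<open>B > 0\<close> by (intro ln_le_log_majorant) simp
    then show "ln (?S Y ^ 2) \<le> ln B + ?q Y" using nz[of Y] \<open>B > 0\<close> by (simp add: ln_div)
  qed
  also have "\<dots> = (2 * L - 2) * ln B + (\<Sum>Y\<in>Pow I. ?q Y) - 2 * ?q X"
    unfolding split[of ?q] sum_T signed_sum_complement[OF X]
    by (simp add: sum.distrib card_rest)
  also have "\<dots> \<le> (2 * L - 2) * ln B + 2 * L * (- 13/45) - 2 * (- 8/5)"
  proof -
    have "(\<Sum>Y\<in>Pow I. ?q Y) \<le> 2 * L * (- 13/45)"
      using sum_cubic_signed_sums[OF I \<open>N > 0\<close> N] twoL by (simp add: B_def K_def)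
    moreover have "- 8/5 \<le> ?q X" using \<open>B > 0\<close> by (intro log_majorant_ge) simp
    ultimately show ?thesis by linarith
  qed
  finally have main: "L * (13/45) - 8/5 - (L - 1) * ln B \<le> ln (?S X ^ 2)"
    by (simp add: algebra_simps)
  \<comment> \<open>The loss \<open>8/5\<close> is smaller than the gain \<open>(13/45 - 1/4) * L\<close> once \<open>L \<ge> 2 ^ 7\<close>.\<close>
  have "(2::real) ^ 7 \<le> L" unfolding L_def using K by (intro power_increasing) auto
  then have L: "L \<ge> 128" by simp
  have "(L - 1) * (2 / real K) \<le> (L - 1) * (1/4)"
    using K L by (intro mult_left_mono) (auto simp: field_simps)
  also have "\<dots> \<le> L * (13/45) - 8/5" using L by simp
  finally show ?thesis using main unfolding L_def[symmetric] B_def[symmetric]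
    by (simp add: right_diff_distrib)
qed

lemma C_le_1:
  assumes "K \<ge> 1"
  shows "C K \<le> 1"
proof -
  have "(2::real) powr (1 - real K) \<le> 2 powr 0" using assms by (intro powr_mono) auto
  then have base: "0 \<le> 1 - 2 powr (1 - real K)" "1 - 2 powr (1 - real K) \<le> 1" by auto
  have "0 \<le> ((2::real) ^ (K - 1) - 1) / 2" by simp
  from powr_mono2[OF this base] show ?thesis by (simp add: C_def)
qed

theorem corollary1p2:
  fixes a :: "nat \<Rightarrow> nat" and K M :: nat and N :: real
  assumes "K \<ge> 8"
    and "\<And>n. n \<in> {1..K} \<Longrightarrow> a n > 0"
    and "inj_on (\<lambda>n. squarefree_part (a n)) {1..K}"
    and "\<And>n. n \<in> {1..K} \<Longrightarrow> real (a n) \<le> N"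
    and "1 \<le> M" and "M \<le> K"
  shows "\<bar>(\<Sum>n\<in>{1..M}. sqrt (real (a n))) - (\<Sum>n\<in>{M<..K}. sqrt (real (a n)))\<bar>
    \<ge> C K * exp ((2 ^ (K - 1) - 1) / real K)
        / (real K * N) powr (2 ^ (K - 2) - 1 / 2)"
proof -
  let ?S = "signed_sum (\<lambda>i. sqrt (real (a i))) {1..K} {1..M}"
  define B L where "B = real K * N" and "L = (2::real) ^ (K - 1)"
  have "real (a 1) \<le> N" "a 1 > 0" using assms(1,2,4) by auto
  then have "N > 0" by linarith
  then have "B > 0" using assms(1) by (simp add: B_def)
  have S: "?S = (\<Sum>n\<in>{1..M}. sqrt (real (a n))) - (\<Sum>n\<in>{M<..K}. sqrt (real (a n)))"
  proof -
    have "{1..K} \<inter> {1..M} = {1..M}" "{1..K} \<inter> - {1..M} = {M<..K}" using assms(5,6) by auto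
    then show ?thesis
      unfolding signed_sum_def sum.If_cases[OF finite_atLeastAtMost] Collect_mem_eq
      by (simp add: sum_negf min_absorb2[OF assms(6)])
  qed
  have "?S \<noteq> 0" by (rule signed_sum_sqrt_nonzero) (use assms in auto)
  have "K - 1 = Suc (K - 2)" using assms(1) by simp
  then have expo: "(2::real) ^ (K - 2) - 1 / 2 = (L - 1) / 2"
    by (simp add: L_def field_simps)
  have "ln (?S ^ 2) = ln (\<bar>?S\<bar> ^ 2)" by simp
  also have "\<dots> = 2 * ln \<bar>?S\<bar>" using \<open>?S \<noteq> 0\<close> by (subst ln_realpow) auto
  finally have ln_square: "ln (?S ^ 2) = 2 * ln \<bar>?S\<bar>" .
  have "(L - 1) * (2 / real K - ln B) \<le> ln (?S ^ 2)"
    using ln_signed_sum_lower_bound[of "{1..K}" a N "{1..M}"] assms by (simp add: L_def B_def)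
  then have ln_le: "(L - 1) / real K - (L - 1) / 2 * ln B \<le> ln \<bar>?S\<bar>"
    unfolding ln_square using assms(1) by (simp add: field_simps)
  have "C K * exp ((L - 1) / real K) / B powr ((L - 1) / 2)
      \<le> 1 * exp ((L - 1) / real K) / B powr ((L - 1) / 2)"
    using C_le_1[of K] assms(1) by (intro divide_right_mono mult_right_mono) auto
  also have "\<dots> = exp ((L - 1) / real K - (L - 1) / 2 * ln B)"
    using \<open>B > 0\<close> by (simp add: powr_def exp_diff)
  also have "\<dots> \<le> exp (ln \<bar>?S\<bar>)" using ln_le by simp
  also have "\<dots> = \<bar>?S\<bar>" using \<open>?S \<noteq> 0\<close> by simp
  finally show ?thesis unfolding expo S B_def[symmetric] L_def[symmetric] .
qed

end
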